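(* Let $p\ge3$ be an integer, $n=2p+1$, $m=\binom n2=p(2p+1)$, and let the rows of the $m\times n$ grid be indexed by the edges of $K_n$ and its columns by the vertices of $K_n$. Let $N_0=p(2p+1)(2p-1)$, which is the number of non-incidence cells of the grid. Let $G$ be a simple augmented bipartite configuration on this grid whose one-edge set $E_1$ is the set of all incidence cells and whose two-edges are pairs of non-incidence cells, and let $H$ be the number of cells of the grid lying in no one-edge and no two-edge of $G$. Then $|E_1|=2p(2p+1)=z(m,n)$, $$|E_2|\le\left\lfloor\frac{N_0}2\right\rfloor,\qquad H=N_0-2|E_2|\ge N_0-2\left\lfloor\frac{N_0}2\right\rfloor,\qquad H\equiv N_0\pmod 2,$$ and hence $$R(G)=|E_1|+|E_2|\le 2p(2p+1)+\left\lfloor\frac{p(2p+1)(2p-1)}2\right\rfloor=\left\lfloor\frac{p(2p+1)(2p+3)}2\right\rfloor=Z(n),$$ with equality if and only if $|E_2|=\lfloor N_0/2\rfloor$. In particular, when $p$ is odd, the bound $R(G)=Z(n)$ is attained only with $H=1$ and $|E_2|=\bigl(p(2p+1)(2p-1)-1\bigr)/2$, while for even $p$ attaining it requires $H=0$ and $|E_2|=p(2p+1)(2p-1)/2$.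
   Context: A cell is a pair (row, column). The cell $(e,v)$, with $e$ an edge and $v$ a vertex of $K_n$, is an incidence cell if $v\in e$, and a non-incidence cell otherwise. An augmented bipartite configuration $G$ consists of a set $E_1$ of one-edges (single cells) and a set $E_2$ of two-edges (unordered pairs of distinct cells); it is simple if distinct elements of $E_1\cup E_2$ have disjoint supports (sets of cells). $R(G)=|E_1|+|E_2|$. $z(m,n)$ is the classical Zarankiewicz number: the maximum number of edges in a $C_4$-free bipartite graph with parts of sizes $m$ and $n$. $Z(n)=\left\lfloor\frac{n(n-1)(n+2)}4\right\rfloor$. *)

theory Defs
  imports Complex_Main "HOL-Library.Ramsey" "HOL-Library.Disjoint_Sets" "HOL-Number_Theory.Cong"
begin

section \<open>The Zarankiewicz number\<close>

definition bipartite_graph :: "'v set \<Rightarrow> 'v set \<Rightarrow> 'v set set \<Rightarrow> bool" where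
  "bipartite_graph X Y E \<longleftrightarrow> X \<inter> Y = {} \<and> E \<subseteq> {{x, y} | x y. x \<in> X \<and> y \<in> Y}"

definition C4_free :: "'v set set \<Rightarrow> bool" where
  "C4_free E \<longleftrightarrow>
     \<not> (\<exists>a b c d. distinct [a, b, c, d] \<and> {a, b} \<in> E \<and> {b, c} \<in> E \<and> {c, d} \<in> E \<and> {d, a} \<in> E)"

text \<open>Every finite graph has an isomorphic copy with vertices in \<^typ>\<open>nat\<close>, so restricting to this
  vertex type loses nothing.\<close>

definition C4_free_bipartite_sizes :: "nat \<Rightarrow> nat \<Rightarrow> nat set" where
  "C4_free_bipartite_sizes m n =
     {card E | (E :: nat set set) X Y.
        finite X \<and> card X = m \<and> finite Y \<and> card Y = n \<and> bipartite_graph X Y E \<and> C4_free E}"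

definition zarankiewicz :: "nat \<Rightarrow> nat \<Rightarrow> nat" where
  "zarankiewicz m n = Max (C4_free_bipartite_sizes m n)"

lemma C4_free_bipartite_sizes_le:
  assumes "k \<in> C4_free_bipartite_sizes m n"
  shows "k \<le> m * n"
proof -
  obtain E :: "nat set set" and X Y where
    E: "k = card E" "finite X" "card X = m" "finite Y" "card Y = n" "bipartite_graph X Y E"
    using assms by (auto simp: C4_free_bipartite_sizes_def)
  have "E \<subseteq> (\<lambda>(x, y). {x, y}) ` (X \<times> Y)"
    using E(6) by (auto simp: bipartite_graph_def)
  then have "card E \<le> card (X \<times> Y)"
    using E(2,4) by (meson card_image_le card_mono finite_SigmaI finite_imageI le_trans)
  then show ?thesis
    using E by (simp add: card_cartesian_product)
qed

lemma finite_C4_free_bipartite_sizes: "finite (C4_free_bipartite_sizes m n)"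
  using C4_free_bipartite_sizes_le by (meson finite_nat_set_iff_bounded_le)

lemma C4_free_bipartite_sizes_nonempty: "C4_free_bipartite_sizes m n \<noteq> {}"
proof -
  have "bipartite_graph {..<m} {m..<m + n} {}" "C4_free ({} :: nat set set)"
    by (auto simp: bipartite_graph_def C4_free_def)
  then have "card ({} :: nat set set) \<in> C4_free_bipartite_sizes m n"
    unfolding C4_free_bipartite_sizes_def
    by (intro CollectI exI[of _ "{}"] exI[of _ "{..<m}"] exI[of _ "{m..<m + n}"]) auto
  then show ?thesis by blast
qed


section \<open>Augmented bipartite configurations\<close>

text \<open>A cell is a pair (row, column). A one-edge is represented by its cell, a two-edge by the
  two-element set of its cells; \<open>nsets A 2\<close> is the set of two-element subsets of \<open>A\<close>.\<close>

record ('r, 'c) configuration =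
  one_edges :: "('r \<times> 'c) set"
  two_edges :: "('r \<times> 'c) set set"

definition augmented_configuration :: "'r set \<Rightarrow> 'c set \<Rightarrow> ('r, 'c) configuration \<Rightarrow> bool" where
  "augmented_configuration A B G \<longleftrightarrow>
     one_edges G \<subseteq> A \<times> B \<and> two_edges G \<subseteq> nsets (A \<times> B) 2"

text \<open>An edge is determined by its support (one-edges have supports of size one, two-edges of size
  two), so distinct edges correspond exactly to distinct members of the set of supports.\<close>

definition supports :: "('r, 'c) configuration \<Rightarrow> ('r \<times> 'c) set set" where
  "supports G = (\<lambda>c. {c}) ` one_edges G \<union> two_edges G"

definition simple_configuration :: "('r, 'c) configuration \<Rightarrow> bool" where
  "simple_configuration G \<longleftrightarrow> pairwise disjnt (supports G)"

definition num_edges :: "('r, 'c) configuration \<Rightarrow> nat" where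
  "num_edges G = card (one_edges G) + card (two_edges G)"

definition uncovered_cells :: "'r set \<Rightarrow> 'c set \<Rightarrow> ('r, 'c) configuration \<Rightarrow> ('r \<times> 'c) set" where
  "uncovered_cells A B G = {c \<in> A \<times> B. c \<notin> one_edges G \<and> (\<forall>e \<in> two_edges G. c \<notin> e)}"


section \<open>The incidence grid of the complete graph\<close>

definition K_vertices :: "nat \<Rightarrow> nat set" where
  "K_vertices n = {..<n}"

definition K_edges :: "nat \<Rightarrow> nat set set" where
  "K_edges n = nsets (K_vertices n) 2"

definition incidence_cells :: "nat \<Rightarrow> (nat set \<times> nat) set" where
  "incidence_cells n = {(e, v) \<in> K_edges n \<times> K_vertices n. v \<in> e}"

definition non_incidence_cells :: "nat \<Rightarrow> (nat set \<times> nat) set" where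
  "non_incidence_cells n = {(e, v) \<in> K_edges n \<times> K_vertices n. v \<notin> e}"

definition Z_bound :: "nat \<Rightarrow> nat" where
  "Z_bound n = n * (n - 1) * (n + 2) div 4"

end

theory Submission
  imports Defs
begin

text \<open>
  Everything except the value of the Zarankiewicz number is counting pairs: the two-edges of
  \<open>G\<close> are disjoint pairs inside the \<open>N\<^sub>0\<close> non-incidence cells, so they use up \<open>2 |E\<^sub>2|\<close> of them and
  leave \<open>H = N\<^sub>0 - 2 |E\<^sub>2|\<close> (card_uncovered_by_pairs).  Since \<open>|E\<^sub>1|\<close> is prescribed, maximising
  \<open>R(G)\<close> amounts to minimising \<open>H\<close>, whose least conceivable value is the parity of
  \<open>N\<^sub>0 = p (2 p + 1) (2 p - 1)\<close>, that is, the parity of \<open>p\<close>.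

  The Zarankiewicz number \<open>z(m, n)\<close> with \<open>m = n choose 2\<close> equals \<open>2 m\<close>.  A bipartite graph is
  \<open>C\<^sub>4\<close>-free exactly if no pair of columns lies in the neighbourhoods of two rows.  Rows of degree
  \<open>d\<^sub>x\<close> thus occupy \<open>\<Sum>\<^sub>x (d\<^sub>x choose 2) \<le> n choose 2\<close> distinct pairs of columns, and
  \<open>d \<le> 1 + (d choose 2)\<close> turns this into \<open>\<Sum>\<^sub>x d\<^sub>x \<le> m + (n choose 2)\<close>
  (C4_free_bipartite_sizes_le_choose).  Rows of degree \<open>2\<close> give equality in the last estimate,
  and using every pair of columns once is the incidence graph of \<open>K\<^sub>n\<close>, which therefore attains the
  bound \<open>2 m\<close>.
\<close>

section \<open>Disjoint pairs in a finite set\<close>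

lemma card_uncovered_by_pairs:
  assumes "finite D" "P \<subseteq> nsets D 2" "pairwise disjnt P"
  shows "card (D - \<Union>P) + 2 * card P = card D"
proof -
  have sub: "\<Union>P \<subseteq> D"
    using assms(2) by (auto simp: nsets_def)
  have "card (\<Union>P) = sum card P"
    using assms(2,3) by (intro card_Union_disjoint) (auto simp: nsets_def)
  also have "\<dots> = (\<Sum>e\<in>P. 2)"
    using assms(2) by (intro sum.cong) (auto simp: nsets_def)
  finally have "card (\<Union>P) = 2 * card P"
    by simp
  moreover have "card (D - \<Union>P) + card (\<Union>P) = card D"
    using sub assms(1) by (metis card_Diff_subset card_mono finite_subset le_add_diff_inverse2)
  ultimately show ?thesis
    by simp
qed


section \<open>Counting cells of the incidence grid\<close>

lemma finite_K_edges: "finite (K_edges n)"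
  by (simp add: K_edges_def K_vertices_def finite_imp_finite_nsets)

lemma card_K_edges: "card (K_edges n) = n choose 2"
  by (simp add: K_edges_def K_vertices_def card_nsets)

lemma K_edgesD:
  assumes "e \<in> K_edges n"
  shows "finite e" "card e = 2" "e \<subseteq> K_vertices n"
  using assms by (auto simp: K_edges_def nsets_def)

lemma card_incidence_cells: "card (incidence_cells n) = 2 * (n choose 2)"
proof -
  have "incidence_cells n = Sigma (K_edges n) (\<lambda>e. e)"
    using K_edgesD(3) by (auto simp: incidence_cells_def)
  then show ?thesis
    by (simp add: card_SigmaI finite_K_edges K_edgesD card_K_edges)
qed

lemma finite_non_incidence_cells: "finite (non_incidence_cells n)"
proof (rule finite_subset)
  show "non_incidence_cells n \<subseteq> K_edges n \<times> K_vertices n"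
    by (auto simp: non_incidence_cells_def)
qed (simp add: finite_K_edges K_vertices_def)

lemma card_non_incidence_cells: "card (non_incidence_cells n) = (n choose 2) * (n - 2)"
proof -
  have eq: "non_incidence_cells n = Sigma (K_edges n) (\<lambda>e. K_vertices n - e)"
    by (auto simp: non_incidence_cells_def)
  have "card (K_vertices n - e) = n - 2" if "e \<in> K_edges n" for e
    using K_edgesD[OF that] by (simp add: card_Diff_subset) (simp add: K_vertices_def)
  then show ?thesis
    unfolding eq by (simp add: card_SigmaI finite_K_edges K_vertices_def card_K_edges)
qed


section \<open>The Zarankiewicz number of the incidence grid\<close>

lemma le_Suc_choose_two: "d \<le> Suc (d choose 2)"
proof (induction d)
  case (Suc d)
  then show ?case
    by (cases d) (auto simp: numeral_2_eq_2)
qed simp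

text \<open>
  Two rows with two common neighbours would close a four-cycle, so the pairs of columns inside the
  neighbourhoods of different rows are different and number at most \<open>n choose 2\<close> altogether.
  Trading degrees for pairs through \<open>d \<le> 1 + (d choose 2)\<close> costs \<open>1\<close> per row, the summand \<open>m\<close>.
\<close>
lemma C4_free_bipartite_sizes_le_choose:
  assumes "k \<in> C4_free_bipartite_sizes m n"
  shows "k \<le> m + (n choose 2)"
proof -
  obtain E :: "nat set set" and X Y where
    k: "k = card E" and X: "finite X" "card X = m" and Y: "finite Y" "card Y = n"
    and bip: "bipartite_graph X Y E" and C4: "C4_free E"
    using assms by (auto simp: C4_free_bipartite_sizes_def)
  define N where "N x = {y \<in> Y. {x, y} \<in> E}" for x
  have fin: "finite (N x)" for x
    using Y by (simp add: N_def)
  have disj: "nsets (N x) 2 \<inter> nsets (N x') 2 = {}" if "x \<in> X" "x' \<in> X" "x \<noteq> x'" for x x'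
  proof (rule ccontr)
    assume "nsets (N x) 2 \<inter> nsets (N x') 2 \<noteq> {}"
    then obtain s where s: "s \<subseteq> N x" "s \<subseteq> N x'" "card s = 2"
      by (auto simp: nsets_def)
    then obtain y y' where "s = {y, y'}" "y \<noteq> y'"
      by (auto simp: card_2_iff)
    then have y: "y \<noteq> y'" "y \<in> Y" "y' \<in> Y" "{x, y} \<in> E" "{x', y} \<in> E" "{x, y'} \<in> E" "{x', y'} \<in> E"
      using s by (auto simp: N_def)
    moreover have "distinct [x, y, x', y']"
      using y that bip by (auto simp: bipartite_graph_def)
    moreover have "{y, x'} \<in> E" "{y', x} \<in> E"
      using y by (simp_all add: insert_commute)
    ultimately show False
      using C4 unfolding C4_free_def by blast
  qed
  have "(\<Sum>x\<in>X. card (N x) choose 2) = card (\<Union>x\<in>X. nsets (N x) 2)"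
    using X(1) fin disj
    by (subst card_UN_disjoint) (auto simp: finite_imp_finite_nsets card_nsets)
  also have "\<dots> \<le> card (nsets Y 2)"
    using Y(1) by (intro card_mono finite_imp_finite_nsets) (auto simp: nsets_def N_def)
  finally have pairs: "(\<Sum>x\<in>X. card (N x) choose 2) \<le> n choose 2"
    using Y by (simp add: card_nsets)
  have "E \<subseteq> (\<Union>x\<in>X. (\<lambda>y. {x, y}) ` N x)"
    using bip by (fastforce simp: bipartite_graph_def N_def)
  then have "card E \<le> card (\<Union>x\<in>X. (\<lambda>y. {x, y}) ` N x)"
    using X(1) fin by (intro card_mono) auto
  also have "\<dots> \<le> (\<Sum>x\<in>X. card ((\<lambda>y. {x, y}) ` N x))"
    using X(1) by (rule card_UN_le)
  also have "\<dots> \<le> (\<Sum>x\<in>X. card (N x))"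
    by (intro sum_mono card_image_le fin)
  also have "\<dots> \<le> (\<Sum>x\<in>X. Suc (card (N x) choose 2))"
    by (intro sum_mono le_Suc_choose_two)
  also have "\<dots> \<le> m + (n choose 2)"
    using pairs X by (simp add: sum_Suc)
  finally show ?thesis
    using k by simp
qed

text \<open>
  An incidence relation between arbitrary finite sets has a copy as a bipartite graph on \<open>nat\<close>:
  number the rows \<open>0, \<dots>, |A| - 1\<close> and the columns from \<open>|A|\<close> on.  A vertex then shows by its size
  on which side it lies, so a four-cycle must alternate between two rows and two columns.
\<close>
lemma card_incidence_relation_in_C4_free_bipartite_sizes:
  assumes A: "finite A" and B: "finite B" and I: "I \<subseteq> A \<times> B"
    and lin: "\<And>a a' b b'. \<lbrakk>(a, b) \<in> I; (a, b') \<in> I; (a', b) \<in> I; (a', b') \<in> I\<rbrakk> \<Longrightarrow> a = a' \<or> b = b'"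
  shows "card I \<in> C4_free_bipartite_sizes (card A) (card B)"
proof -
  define k where "k = card A"
  obtain f where f: "bij_betw f A {0..<k}"
    using ex_bij_betw_finite_nat[OF A] by (auto simp: k_def)
  obtain g where g: "bij_betw g B {k..<k + card B}"
    using B finite_same_card_bij[of B "{k..<k + card B}"] by auto
  have fk: "f a < k" if "a \<in> A" for a
    using f that by (auto simp: bij_betw_def)
  have gk: "k \<le> g b" if "b \<in> B" for b
    using g that by (auto simp: bij_betw_def)
  have finj: "f a = f a' \<longleftrightarrow> a = a'" if "a \<in> A" "a' \<in> A" for a a'
    using f that by (auto simp: bij_betw_def inj_on_def)
  have ginj: "g b = g b' \<longleftrightarrow> b = b'" if "b \<in> B" "b' \<in> B" for b b'
    using g that by (auto simp: bij_betw_def inj_on_def)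
  define E where "E = (\<lambda>(a, b). {f a, g b}) ` I"
  have inj: "inj_on (\<lambda>(a, b). {f a, g b}) I"
  proof (rule inj_onI, clarify)
    fix a b a' b'
    assume *: "(a, b) \<in> I" "(a', b') \<in> I" "{f a, g b} = {f a', g b'}"
    then have "a \<in> A" "a' \<in> A" "b \<in> B" "b' \<in> B"
      using I by auto
    then show "a = a' \<and> b = b'"
      using * fk gk finj ginj by (metis doubleton_eq_iff leD)
  qed
  have "bipartite_graph {0..<k} {k..<k + card B} E"
    unfolding bipartite_graph_def
  proof
    have "\<exists>x y. {f a, g b} = {x, y} \<and> x \<in> {0..<k} \<and> y \<in> {k..<k + card B}" if "(a, b) \<in> I" for a b
      using that I f g by (intro exI[of _ "f a"] exI[of _ "g b"]) (auto dest: bij_betw_apply)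
    then show "E \<subseteq> {{x, y} | x y. x \<in> {0..<k} \<and> y \<in> {k..<k + card B}}"
      by (auto simp: E_def simp del: atLeastLessThan_iff)
  qed auto
  moreover have "C4_free E"
  proof -
    have E_iff: "{f a, v} \<in> E \<longleftrightarrow> (\<exists>b. v = g b \<and> (a, b) \<in> I)" if "a \<in> A" for a v
    proof
      assume "{f a, v} \<in> E"
      then obtain a' b where ab: "(a', b) \<in> I" "{f a, v} = {f a', g b}"
        by (auto simp: E_def)
      then have "a' \<in> A" "b \<in> B"
        using I by auto
      with ab fk gk finj that have "a = a'" "v = g b"
        by (metis doubleton_eq_iff leD)+
      with ab show "\<exists>b. v = g b \<and> (a, b) \<in> I"
        by auto
    qed (auto simp: E_def)
    have split: "(\<exists>a\<in>A. u = f a) \<or> (\<exists>a\<in>A. v = f a)" if "{u, v} \<in> E" for u v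
    proof -
      obtain a b where "(a, b) \<in> I" "{u, v} = {f a, g b}"
        using \<open>{u, v} \<in> E\<close> by (auto simp: E_def)
      then have "a \<in> A" "u = f a \<or> v = f a"
        using I by (auto simp: doubleton_eq_iff)
      then show ?thesis
        by blast
    qed
    have right: "v \<notin> f ` A" if "{f a, v} \<in> E" "a \<in> A" for a v
      using that E_iff I fk gk by (metis SigmaD2 image_iff leD subsetD)
    have no_cycle: False
      if cyc: "distinct [u, v, w, x]" "{u, v} \<in> E" "{v, w} \<in> E" "{w, x} \<in> E" "{x, u} \<in> E"
        and u: "u \<in> f ` A" for u v w x
    proof -
      obtain a where a: "a \<in> A" "u = f a"
        using u by auto
      have "v \<notin> f ` A"
        using right cyc(2) a by auto
      then obtain a' where a': "a' \<in> A" "w = f a'"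
        using split[OF cyc(3)] by auto
      have edges: "{f a, v} \<in> E" "{f a', v} \<in> E" "{f a', x} \<in> E" "{f a, x} \<in> E"
        using cyc a a' by (auto simp: insert_commute)
      obtain b b' where "v = g b" "x = g b'" "(a, b) \<in> I" "(a, b') \<in> I"
        using edges(1,4) a E_iff by auto
      moreover from this edges(2,3) a' have "(a', b) \<in> I" "(a', b') \<in> I"
        using E_iff I ginj by (metis SigmaD2 subsetD)+
      ultimately show False
        using lin cyc(1) a a' by fastforce
    qed
    show ?thesis
      unfolding C4_free_def
    proof (intro notI, elim exE conjE)
      fix u v w x
      assume cyc: "distinct [u, v, w, x]" "{u, v} \<in> E" "{v, w} \<in> E" "{w, x} \<in> E" "{x, u} \<in> E"
      \<comment> \<open>If \<open>u\<close> is a column then \<open>v\<close> is a row, and the cycle is read from \<open>v\<close> instead.\<close>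
      have "u \<in> f ` A \<or> v \<in> f ` A"
        using split[OF cyc(2)] by auto
      then show False
        using no_cycle[of u v w x] no_cycle[of v w x u] cyc by auto
    qed
  qed
  moreover have "card E = card I"
    using inj by (simp add: E_def card_image)
  ultimately show ?thesis
    unfolding C4_free_bipartite_sizes_def k_def
    by (intro CollectI exI[of _ E] exI[of _ "{0..<k}"] exI[of _ "{k..<k + card B}"])
      (auto simp: k_def)
qed

text \<open>
  The incidence graph of \<open>K\<^sub>n\<close> attains the bound: an edge of \<open>K\<^sub>n\<close> is determined by two of its
  vertices, so its incidence relation contains no four-cycle.
\<close>
theorem zarankiewicz_choose_two: "zarankiewicz (n choose 2) n = 2 * (n choose 2)"
  unfolding zarankiewicz_def
proof (rule Max_eqI)
  show "finite (C4_free_bipartite_sizes (n choose 2) n)"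
    by (rule finite_C4_free_bipartite_sizes)
  show "k \<le> 2 * (n choose 2)" if "k \<in> C4_free_bipartite_sizes (n choose 2) n" for k
    using C4_free_bipartite_sizes_le_choose[OF that] by simp
  have "card (incidence_cells n) \<in> C4_free_bipartite_sizes (card (K_edges n)) (card (K_vertices n))"
  proof (rule card_incidence_relation_in_C4_free_bipartite_sizes)
    show "incidence_cells n \<subseteq> K_edges n \<times> K_vertices n"
      by (auto simp: incidence_cells_def)
    fix e e' v v'
    assume inc: "(e, v) \<in> incidence_cells n" "(e, v') \<in> incidence_cells n"
      "(e', v) \<in> incidence_cells n" "(e', v') \<in> incidence_cells n"
    have "d = {v, v'}" if "v \<noteq> v'" "d = e \<or> d = e'" for d
    proof -
      have "d \<in> K_edges n" "{v, v'} \<subseteq> d"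
        using inc that by (auto simp: incidence_cells_def)
      then show ?thesis
        using K_edgesD[of d n] that(1) by (metis card_2_iff card_subset_eq)
    qed
    then show "e = e' \<or> v = v'"
      by blast
  qed (auto simp: finite_K_edges K_vertices_def)
  then show "2 * (n choose 2) \<in> C4_free_bipartite_sizes (n choose 2) n"
    by (simp add: card_incidence_cells card_K_edges K_vertices_def)
qed


section \<open>Configurations over the incidence grid\<close>

theorem lemma4p5:
  fixes p n m N\<^sub>0 H :: nat
    and G :: "(nat set, nat) configuration"
  assumes "p \<ge> 3"
    and "n = 2 * p + 1"
    and "m = n choose 2"
    and "N\<^sub>0 = p * (2 * p + 1) * (2 * p - 1)"
    and "augmented_configuration (K_edges n) (K_vertices n) G"
    and "simple_configuration G"
    and "one_edges G = incidence_cells n"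
    and "\<forall>e \<in> two_edges G. e \<subseteq> non_incidence_cells n"
    and "H = card (uncovered_cells (K_edges n) (K_vertices n) G)"
  shows "m = p * (2 * p + 1) \<and> card (K_edges n) = m \<and> card (K_vertices n) = n
    \<and> card (non_incidence_cells n) = N\<^sub>0
    \<and> card (one_edges G) = 2 * p * (2 * p + 1)
    \<and> 2 * p * (2 * p + 1) = zarankiewicz m n
    \<and> card (two_edges G) \<le> N\<^sub>0 div 2
    \<and> int H = int N\<^sub>0 - 2 * int (card (two_edges G))
    \<and> int H \<ge> int N\<^sub>0 - 2 * int (N\<^sub>0 div 2)
    \<and> [H = N\<^sub>0] (mod 2)
    \<and> num_edges G = card (one_edges G) + card (two_edges G)
    \<and> num_edges G \<le> 2 * p * (2 * p + 1) + p * (2 * p + 1) * (2 * p - 1) div 2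
    \<and> 2 * p * (2 * p + 1) + p * (2 * p + 1) * (2 * p - 1) div 2
        = p * (2 * p + 1) * (2 * p + 3) div 2
    \<and> p * (2 * p + 1) * (2 * p + 3) div 2 = Z_bound n
    \<and> (num_edges G = Z_bound n \<longleftrightarrow> card (two_edges G) = N\<^sub>0 div 2)
    \<and> (odd p \<longrightarrow> num_edges G = Z_bound n \<longrightarrow>
         H = 1 \<and> real (card (two_edges G)) = (real (p * (2 * p + 1) * (2 * p - 1)) - 1) / 2)
    \<and> (even p \<longrightarrow> num_edges G = Z_bound n \<longrightarrow>
         H = 0 \<and> real (card (two_edges G)) = real (p * (2 * p + 1) * (2 * p - 1)) / 2)"
proof -
  let ?D = "non_incidence_cells n" and ?P = "two_edges G"
  have m: "m = p * (2 * p + 1)"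
    using assms(2,3) by (simp add: choose_two algebra_simps)
  have edges: "card (K_edges n) = m" and vertices: "card (K_vertices n) = n"
    using assms(3) by (simp_all add: card_K_edges K_vertices_def)
  have cells: "card ?D = N\<^sub>0"
    using m assms(2,3,4) by (simp add: card_non_incidence_cells)
  have one: "card (one_edges G) = 2 * p * (2 * p + 1)"
    using m assms(3,7) by (simp add: card_incidence_cells)
  have zar: "2 * p * (2 * p + 1) = zarankiewicz m n"
    using m assms(3) zarankiewicz_choose_two[of n] by simp

  have "?P \<subseteq> nsets ?D 2"
    using assms(5,8) by (auto simp: augmented_configuration_def nsets_def)
  moreover have "pairwise disjnt ?P"
    using assms(6) unfolding simple_configuration_def supports_def
    by (rule pairwise_subset) simp
  moreover have "uncovered_cells (K_edges n) (K_vertices n) G = ?D - \<Union>?P"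
    using assms(7)
    by (auto simp: uncovered_cells_def incidence_cells_def non_incidence_cells_def)
  ultimately have H: "H + 2 * card ?P = N\<^sub>0"
    using card_uncovered_by_pairs[of ?D ?P] assms(9) cells
    by (simp add: finite_non_incidence_cells)

  have num: "num_edges G = 2 * p * (2 * p + 1) + card ?P"
    by (simp add: num_edges_def one)
  have "p * (2 * p + 1) * (2 * p + 3) = 2 * (2 * p * (2 * p + 1)) + N\<^sub>0"
    using assms(1) unfolding assms(4) by (cases p) (auto simp: algebra_simps)
  then have total: "2 * p * (2 * p + 1) + N\<^sub>0 div 2 = p * (2 * p + 1) * (2 * p + 3) div 2"
    by simp
  have "n * (n - 1) * (n + 2) = 2 * (p * (2 * p + 1) * (2 * p + 3))"
    using assms(2) by (simp add: algebra_simps)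
  then have Z: "p * (2 * p + 1) * (2 * p + 3) div 2 = Z_bound n"
    by (simp add: Z_bound_def)
  have parity: "odd N\<^sub>0 \<longleftrightarrow> odd p"
    using assms(1) unfolding assms(4) by simp
  have le: "card ?P \<le> N\<^sub>0 div 2"
    using H by simp
  have eq: "num_edges G = Z_bound n \<longleftrightarrow> card ?P = N\<^sub>0 div 2"
    using num total Z by linarith
  have odd: "H = 1 \<and> real (card ?P) = (real N\<^sub>0 - 1) / 2"
    if "odd p" "num_edges G = Z_bound n"
  proof -
    have "H = 1"
      using H eq that parity by presburger
    then show ?thesis
      using H by auto
  qed
  have even: "H = 0 \<and> real (card ?P) = real N\<^sub>0 / 2"
    if "even p" "num_edges G = Z_bound n"
  proof -
    have "H = 0"
      using H eq that parity by presburger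
    then show ?thesis
      using H by auto
  qed
  have int_H: "int H = int N\<^sub>0 - 2 * int (card ?P)"
    using H by simp
  moreover have "int H \<ge> int N\<^sub>0 - 2 * int (N\<^sub>0 div 2)"
    using int_H le by linarith
  moreover have "[H = N\<^sub>0] (mod 2)"
    unfolding cong_def H[symmetric] by simp
  moreover have "num_edges G = card (one_edges G) + card ?P"
    by (simp add: num_edges_def)
  moreover have "num_edges G \<le> 2 * p * (2 * p + 1) + N\<^sub>0 div 2"
    using num le by simp
  ultimately show ?thesis
    using m edges vertices cells one zar le total Z eq odd even
    unfolding assms(4) by blast
qed

end
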